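(* Let $X$ be a non-negative absolutely continuous random variable with (finite) variance $\sigma^2$, $\sigma>0$. Then the sum of the cumulative residual entropy and the cumulative entropy of $X$ satisfies $$\mathcal{E}(X)+\mathcal{CE}(X)\leq \sum_{n=1}^{+\infty}\frac{\sqrt{2}\,\sigma}{n\sqrt{n+1}}\simeq 3.09\,\sigma,$$ where $\simeq$ denotes the approximate numerical value of the series.
   Context: $\log$ is the natural logarithm, with the convention $0\log 0=0$. For a non-negative absolutely continuous random variable $X$ with cumulative distribution function $F$, the cumulative residual entropy is $\mathcal{E}(X)=-\int_0^{+\infty}(1-F(x))\log(1-F(x))\,dx$ and the cumulative entropy is $\mathcal{CE}(X)=-\int_0^{+\infty}F(x)\log F(x)\,dx$. *)

theory Defs
  imports "HOL-Probability.Probability"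
begin

(* The convention 0 log 0 = 0 is automatic: the factor in front of the logarithm vanishes. *)

definition cumulative_residual_entropy :: "'a measure \<Rightarrow> ('a \<Rightarrow> real) \<Rightarrow> real" where
  "cumulative_residual_entropy M X =
     - (LINT x:{0..}|lborel.
          (1 - cdf (distr M borel X) x) * ln (1 - cdf (distr M borel X) x))"

definition cumulative_entropy :: "'a measure \<Rightarrow> ('a \<Rightarrow> real) \<Rightarrow> real" where
  "cumulative_entropy M X =
     - (LINT x:{0..}|lborel. cdf (distr M borel X) x * ln (cdf (distr M borel X) x))"

(* A Bochner integral is 0 when the integrand is not integrable, so finiteness of the
   two entropies is recorded by separate predicates. *)

definition finite_cumulative_residual_entropy :: "'a measure \<Rightarrow> ('a \<Rightarrow> real) \<Rightarrow> bool" where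
  "finite_cumulative_residual_entropy M X \<longleftrightarrow>
     set_integrable lborel {0..}
       (\<lambda>x. (1 - cdf (distr M borel X) x) * ln (1 - cdf (distr M borel X) x))"

definition finite_cumulative_entropy :: "'a measure \<Rightarrow> ('a \<Rightarrow> real) \<Rightarrow> bool" where
  "finite_cumulative_entropy M X \<longleftrightarrow>
     set_integrable lborel {0..}
       (\<lambda>x. cdf (distr M borel X) x * ln (cdf (distr M borel X) x))"

(* The term of index n (n = 0, 1, ...) is the summand of the series over 1, 2, ... at n + 1. *)

definition entropy_bound_term :: "real \<Rightarrow> nat \<Rightarrow> real" where
  "entropy_bound_term \<sigma> n =
     sqrt 2 * \<sigma> / (real (Suc n) * sqrt (real (Suc n) + 1))"

end

theory Submission
  imports Defs "HOL-Real_Asymp.Real_Asymp"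
begin

text \<open>
  Let \<open>Q\<close> be the quantile function of \<open>X\<close>, so that \<open>Q(U)\<close> has the law of \<open>X\<close> when \<open>U\<close> is
  uniform on \<open>(0, 1)\<close>, and \<open>u \<le> F(x)\<close> holds exactly when \<open>Q(u) \<le> x\<close>.  Since \<open>X \<ge> 0\<close>, writing
  \<open>Q(u)\<close> as the length of \<open>{x \<ge> 0. F(x) < u}\<close> and exchanging the integrals gives, for every
  score \<open>\<phi>\<close>, that \<open>E[Q(U) \<phi>(U)]\<close> is the integral over \<open>x \<ge> 0\<close> of \<open>\<integral>\<phi>\<close> over \<open>(F(x), 1)\<close>
  (\<open>integral_quantile_times\<close>).  The score \<open>1 + ln u\<close> has tail integral \<open>- p ln p\<close> and thus yields
  the cumulative entropy; its negated mirror image \<open>- 1 - ln (1 - u)\<close> yields the cumulative residual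
  entropy.  Hence the sum of the two entropies is \<open>E[Q(U) (ln U - ln (1 - U))]\<close>.

  The score \<open>ln u - ln (1 - u)\<close> has mean \<open>0\<close>, so \<open>Q(U)\<close> can be centred at its mean.  Its second
  moment is at most \<open>4\<close>, because \<open>ln U\<close> and \<open>ln (1 - U)\<close> both have second moment \<open>2\<close> and their
  product is nonnegative.  The inequality of arithmetic and geometric means, weighted to act as
  Cauchy-Schwarz, bounds the sum of the entropies by \<open>2 \<sigma>\<close> (\<open>entropies_via_quantile\<close>).
  Square integrability of both factors is also what makes the two entropies finite.

  The series is compared with telescoping sums.  This proves convergence and places its value
  within \<open>0.005 \<sigma>\<close> of \<open>3.09 \<sigma>\<close> (\<open>entropy_bound_series\<close>), well above \<open>2 \<sigma>\<close>.
\<close>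

section \<open>Improper integrals of logarithms\<close>

lemma improper_integral_nonneg:
  fixes F f :: "real \<Rightarrow> real"
  assumes "a < b"
    and F: "\<And>x. a < x \<Longrightarrow> x < b \<Longrightarrow> (F has_real_derivative f x) (at x)"
    and f: "\<And>x. a < x \<Longrightarrow> x < b \<Longrightarrow> isCont f x"
    and pos: "\<And>x. a < x \<Longrightarrow> x < b \<Longrightarrow> 0 \<le> f x"
    and A: "(F \<longlongrightarrow> A) (at_right a)" and B: "(F \<longlongrightarrow> B) (at_left b)"
  shows "set_integrable lborel {a<..<b} f" "(LINT x:{a<..<b}|lborel. f x) = B - A"
proof -
  have lim: "((F \<circ> real_of_ereal) \<longlongrightarrow> A) (at_right (ereal a))"
     "((F \<circ> real_of_ereal) \<longlongrightarrow> B) (at_left (ereal b))"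
    using A B by (simp_all add: ereal_tendsto_simps1)
  note * = interval_integral_FTC_nonneg[of "ereal a" "ereal b" F f A B, OF _ _ _ _ lim]
  show "set_integrable lborel {a<..<b} f"
    using *(1) assms by simp
  show "(LINT x:{a<..<b}|lborel. f x) = B - A"
    using *(2) assms by (simp add: interval_integral_Ioo)
qed

text \<open>
  For an integrand of varying sign, the limits of \<open>F\<close> at the ends do not imply Lebesgue
  integrability, which therefore becomes a hypothesis.
\<close>

lemma improper_integral_eq:
  fixes F f :: "real \<Rightarrow> real"
  assumes "a < b"
    and F: "\<And>x. a < x \<Longrightarrow> x < b \<Longrightarrow> (F has_real_derivative f x) (at x)"
    and f: "\<And>x. a < x \<Longrightarrow> x < b \<Longrightarrow> isCont f x"
    and int: "set_integrable lborel {a<..<b} f"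
    and A: "(F \<longlongrightarrow> A) (at_right a)" and B: "(F \<longlongrightarrow> B) (at_left b)"
  shows "(LINT x:{a<..<b}|lborel. f x) = B - A"
proof -
  have lim: "((F \<circ> real_of_ereal) \<longlongrightarrow> A) (at_right (ereal a))"
     "((F \<circ> real_of_ereal) \<longlongrightarrow> B) (at_left (ereal b))"
    using A B by (simp_all add: ereal_tendsto_simps1)
  have "(LBINT x=ereal a..ereal b. f x) = B - A"
    by (rule interval_integral_FTC_integrable[OF _ _ _ _ lim])
       (use assms in \<open>auto simp flip: has_real_derivative_iff_has_vector_derivative\<close>)
  then show ?thesis
    using assms(1) by (simp add: interval_integral_Ioo)
qed

lemma ln_square_antiderivative:
  fixes x :: real
  assumes "0 < x"
  shows "((\<lambda>u. u * (ln u)\<^sup>2 - 2 * u * ln u + 2 * u) has_real_derivative (ln x)\<^sup>2) (at x)"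
  using assms by (auto intro!: derivative_eq_intros simp: field_simps power2_eq_square)

lemma ln_square_integral:
  "set_integrable lborel {0<..<1} (\<lambda>u::real. (ln u)\<^sup>2)"
  "(LINT u:{0<..<1}|lborel. (ln (u::real))\<^sup>2) = 2"
proof -
  let ?F = "\<lambda>u::real. u * (ln u)\<^sup>2 - 2 * u * ln u + 2 * u"
  note D = ln_square_antiderivative
  have A: "(?F \<longlongrightarrow> 0) (at_right 0)" and B: "(?F \<longlongrightarrow> 2) (at_left 1)"
    by real_asymp+
  show "set_integrable lborel {0<..<1} (\<lambda>u::real. (ln u)\<^sup>2)"
    by (rule improper_integral_nonneg(1)[OF _ D _ _ A B]) (auto intro!: continuous_intros)
  show "(LINT u:{0<..<1}|lborel. (ln (u::real))\<^sup>2) = 2"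
    by (subst improper_integral_nonneg(2)[OF _ D _ _ A B]) (auto intro!: continuous_intros)
qed

lemma ln_one_minus_square_integral:
  "set_integrable lborel {0<..<1} (\<lambda>u::real. (ln (1 - u))\<^sup>2)"
  "(LINT u:{0<..<1}|lborel. (ln (1 - u :: real))\<^sup>2) = 2"
proof -
  let ?F = "\<lambda>u::real. - ((1 - u) * (ln (1 - u))\<^sup>2 - 2 * (1 - u) * ln (1 - u) + 2 * (1 - u))"
  have D: "(?F has_real_derivative (ln (1 - x))\<^sup>2) (at x)" if "x < 1" for x
  proof -
    have "((\<lambda>u. 1 - u) has_real_derivative - 1) (at x)"
      by (auto intro!: derivative_eq_intros)
    from DERIV_minus[OF DERIV_chain2[OF ln_square_antiderivative this]] that show ?thesis
      by simp
  qed
  have A: "(?F \<longlongrightarrow> -2) (at_right 0)" and B: "(?F \<longlongrightarrow> 0) (at_left 1)"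
    by real_asymp+
  show "set_integrable lborel {0<..<1} (\<lambda>u::real. (ln (1 - u))\<^sup>2)"
    by (rule improper_integral_nonneg(1)[OF _ D _ _ A B]) (auto intro!: continuous_intros)
  show "(LINT u:{0<..<1}|lborel. (ln (1 - u :: real))\<^sup>2) = 2"
    by (subst improper_integral_nonneg(2)[OF _ D _ _ A B]) (auto intro!: continuous_intros)
qed

section \<open>Entropies as expectations of the quantile function\<close>

abbreviation uniform01 :: "real measure" where
  "uniform01 \<equiv> restrict_space lborel {0<..<1}"

lemma prob_space_uniform01: "prob_space uniform01"
  by (auto simp: space_restrict_space emeasure_restrict_space intro!: prob_spaceI)

lemma integral_uniform01:
  fixes g :: "real \<Rightarrow> real"
  shows "integrable uniform01 g \<longleftrightarrow> set_integrable lborel {0<..<1} g"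
    "integral\<^sup>L uniform01 g = (LINT u:{0<..<1}|lborel. g u)"
  by (simp_all add: integrable_restrict_space integral_restrict_space set_integrable_def
      set_lebesgue_integral_def)

text \<open>
  The antiderivative \<open>u ln u\<close> of the score vanishes at \<open>1\<close>, so only the lower end contributes.
  At \<open>p = 0\<close> the right-hand side relies on \<open>0 * ln 0 = 0\<close>, which is also the limit of \<open>u ln u\<close>.
\<close>

lemma integral_tail_score_cumulative:
  assumes "0 \<le> p" "p \<le> (1::real)"
    and "set_integrable lborel {0<..<1} (\<lambda>u::real. 1 + ln u)"
  shows "(LINT u:{p<..<1}|lborel. 1 + ln u) = - (p * ln p)"
proof (cases "p = 1")
  case False
  let ?F = "\<lambda>u::real. u * ln u"
  have "(?F \<longlongrightarrow> p * ln p) (at_right p)"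
  proof (cases "p = 0")
    case True
    have "(?F \<longlongrightarrow> 0) (at_right 0)" by real_asymp
    then show ?thesis using True by simp
  next
    case False
    then show ?thesis by (intro tendsto_intros)
  qed
  moreover have "(?F \<longlongrightarrow> 0) (at_left 1)" by real_asymp
  moreover have "set_integrable lborel {p<..<1} (\<lambda>u. 1 + ln u)"
    by (rule set_integrable_subset[OF assms(3)]) (use assms(1) in auto)
  ultimately have "(LINT u:{p<..<1}|lborel. 1 + ln u) = 0 - p * ln p"
    using False assms(1,2)
    by (intro improper_integral_eq)
       (auto intro!: derivative_eq_intros continuous_intros)
  then show ?thesis by simp
qed (simp add: set_lebesgue_integral_def)

lemma integral_tail_score_residual:
  assumes "0 \<le> p" "p \<le> (1::real)"
    and "set_integrable lborel {0<..<1} (\<lambda>u::real. - 1 - ln (1 - u))"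
  shows "(LINT u:{p<..<1}|lborel. - 1 - ln (1 - u)) = - ((1 - p) * ln (1 - p))"
proof (cases "p = 1")
  case False
  let ?F = "\<lambda>u::real. (1 - u) * ln (1 - u)"
  have "(?F \<longlongrightarrow> (1 - p) * ln (1 - p)) (at_right p)"
    using False by (intro tendsto_intros) auto
  moreover have "(?F \<longlongrightarrow> 0) (at_left 1)" by real_asymp
  moreover have "set_integrable lborel {p<..<1} (\<lambda>u. - 1 - ln (1 - u))"
    by (rule set_integrable_subset[OF assms(3)]) (use assms(1) in auto)
  ultimately have "(LINT u:{p<..<1}|lborel. - 1 - ln (1 - u)) = 0 - (1 - p) * ln (1 - p)"
    using False assms(1,2)
    by (intro improper_integral_eq)
       (auto intro!: derivative_eq_intros continuous_intros)
  then show ?thesis by simp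
qed (simp add: set_lebesgue_integral_def)

text \<open>
  A layer-cake identity: both sides are the two iterated integrals of \<open>\<phi> u\<close> over the region of
  all \<open>(u, x)\<close> with \<open>0 \<le> x\<close> and \<open>C x < u\<close>.  For fixed \<open>u\<close> the region is the interval
  \<open>{0..<I u}\<close>, by the Galois connection between \<open>C\<close> and its pseudoinverse \<open>I\<close>; for fixed
  \<open>x \<ge> 0\<close> it is \<open>{C x<..<1}\<close>.
\<close>

lemma (in cdf_distribution) integral_quantile_times:
  fixes \<phi> :: "real \<Rightarrow> real"
  assumes nonneg: "\<And>u. 0 < u \<Longrightarrow> u < 1 \<Longrightarrow> 0 \<le> I u"
    and \<phi>[measurable]: "\<phi> \<in> borel_measurable borel"
    and int: "integrable uniform01 (\<lambda>u. I u * \<phi> u)"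
  shows "set_integrable lborel {0..} (\<lambda>x. LINT u:{C x<..<1}|lborel. \<phi> u)"
    and "(LINT x:{0..}|lborel. LINT u:{C x<..<1}|lborel. \<phi> u) = (LINT u|uniform01. I u * \<phi> u)"
proof -
  interpret U: prob_space uniform01 by (rule prob_space_uniform01)
  interpret P: pair_sigma_finite uniform01 "lborel :: real measure" ..
  define g :: "real \<times> real \<Rightarrow> real"
    where "g = (\<lambda>(u, x). if 0 \<le> x \<and> C x < u then \<phi> u else 0)"
  have fst_U [measurable]: "fst \<in> borel_measurable (uniform01 \<Otimes>\<^sub>M (lborel :: real measure))"
    by (rule measurable_compose[OF measurable_fst]) (auto intro: measurable_restrict_space1)
  have snd_U [measurable]: "snd \<in> borel_measurable (uniform01 \<Otimes>\<^sub>M (lborel :: real measure))"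
    by (rule measurable_compose[OF measurable_snd]) auto
  have [measurable]: "g \<in> borel_measurable (uniform01 \<Otimes>\<^sub>M lborel)"
    unfolding g_def case_prod_beta by measurable
  have slice: "g (u, x) = indicator {0..<I u} x *\<^sub>R \<phi> u" if "u \<in> space uniform01" for u x
    using that pseudoinverse[of u x] by (auto simp: g_def space_restrict_space indicator_def)
  have nonneg': "0 \<le> I u" if "u \<in> space uniform01" for u
    using that nonneg by (simp add: space_restrict_space)
  have section_integrable: "integrable lborel (\<lambda>x. g (u, x))" if "u \<in> space uniform01" for u
    using that nonneg'[of u] by (simp add: slice)
  have section_integral: "(LINT x|lborel. g (u, x)) = I u * \<phi> u" if "u \<in> space uniform01" for u
    using that nonneg'[of u] by (simp add: slice)
  have section_norm: "(LINT x|lborel. norm (g (u, x))) = norm (I u * \<phi> u)" if "u \<in> space uniform01" for u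
    using that nonneg'[of u] by (simp add: slice abs_mult)
  have "integrable (uniform01 \<Otimes>\<^sub>M lborel) g"
  proof (rule P.Fubini_integrable)
    show "integrable uniform01 (\<lambda>u. LINT x|lborel. norm (g (u, x)))"
      using integrable_norm[OF int] section_norm
      by (subst Bochner_Integration.integrable_cong[OF refl section_norm]) auto
    show "AE u in uniform01. integrable lborel (\<lambda>x. g (u, x))"
      by (rule AE_I2) (rule section_integrable)
  qed simp
  then have g2: "integrable (uniform01 \<Otimes>\<^sub>M lborel) (\<lambda>(u, x). g (u, x))" by simp
  have inner: "(LINT u|uniform01. g (u, x)) = indicator {0..} x *\<^sub>R (LINT u:{C x<..<1}|lborel. \<phi> u)" for x
  proof -
    have "0 \<le> C x" by (rule cdf_nonneg)
    then show ?thesis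
      unfolding integral_uniform01 set_lebesgue_integral_def integral_scaleR_right[symmetric]
      by (intro Bochner_Integration.integral_cong) (auto simp: g_def indicator_def)
  qed
  show "set_integrable lborel {0..} (\<lambda>x. LINT u:{C x<..<1}|lborel. \<phi> u)"
    using P.integrable_snd[OF g2] by (simp add: inner set_integrable_def)
  have "(LINT x:{0..}|lborel. LINT u:{C x<..<1}|lborel. \<phi> u) = (LINT x|lborel. LINT u|uniform01. g (u, x))"
    by (simp add: inner set_lebesgue_integral_def)
  also have "\<dots> = (LINT u|uniform01. LINT x|lborel. g (u, x))"
    using P.Fubini_integral[OF g2] .
  also have "\<dots> = (LINT u|uniform01. I u * \<phi> u)"
    by (rule Bochner_Integration.integral_cong) (auto simp: section_integral)
  finally show "(LINT x:{0..}|lborel. LINT u:{C x<..<1}|lborel. \<phi> u) = (LINT u|uniform01. I u * \<phi> u)" .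
qed

lemma integrable_mult_of_squares:
  fixes f g :: "'a \<Rightarrow> real"
  assumes [measurable]: "f \<in> borel_measurable N" "g \<in> borel_measurable N"
    and "integrable N (\<lambda>x. (f x)\<^sup>2)" "integrable N (\<lambda>x. (g x)\<^sup>2)"
  shows "integrable N (\<lambda>x. f x * g x)"
proof (rule Bochner_Integration.integrable_bound)
  show "integrable N (\<lambda>x. (f x)\<^sup>2 + (g x)\<^sup>2)" using assms by simp
  have "\<bar>a * b\<bar> \<le> a\<^sup>2 + b\<^sup>2" for a b :: real
  proof -
    have "0 \<le> (\<bar>a\<bar> - \<bar>b\<bar>)\<^sup>2" by simp
    also have "\<dots> = a\<^sup>2 + b\<^sup>2 - 2 * \<bar>a * b\<bar>" by (simp add: power2_diff abs_mult)
    finally show ?thesis using abs_ge_zero[of "a * b"] by linarith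
  qed
  then show "AE x in N. norm (f x * g x) \<le> norm ((f x)\<^sup>2 + (g x)\<^sup>2)" by simp
qed simp

lemma (in cdf_distribution) quantile_nonneg:
  assumes "AE x in M. 0 \<le> x" "0 < u" "u < 1"
  shows "0 \<le> I u"
proof (rule ccontr)
  assume neg: "\<not> 0 \<le> I u"
  have "measure M {.. I u} = 0"
  proof (rule measure_eq_0_null_sets, subst AE_iff_null_sets)
    show "AE x in M. x \<notin> {.. I u}" using assms(1) neg by (auto elim!: eventually_mono)
  qed simp
  then have "C (I u) = 0" by (simp add: cdf_def)
  moreover have "u \<le> C (I u)" using pseudoinverse[of u "I u"] assms by simp
  ultimately show False using assms by simp
qed

text \<open>
  The number \<open>m\<close> is arbitrary because the score \<open>ln u - ln (1 - u)\<close> is centred: replacing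
  \<open>I u\<close> by \<open>I u - m\<close> does not change its integral against the score.
\<close>

lemma (in cdf_distribution) entropies_via_quantile:
  assumes nonneg: "AE x in M. 0 \<le> x"
    and sq: "integrable M (\<lambda>x. (x - m)\<^sup>2)"
    and var: "(LINT x|M. (x - m)\<^sup>2) = s\<^sup>2" and "0 < s"
  shows "set_integrable lborel {0..} (\<lambda>x. (1 - C x) * ln (1 - C x))"
    and "set_integrable lborel {0..} (\<lambda>x. C x * ln (C x))"
    and "- (LINT x:{0..}|lborel. (1 - C x) * ln (1 - C x)) + - (LINT x:{0..}|lborel. C x * ln (C x))
      \<le> 2 * s"
proof -
  interpret U: prob_space uniform01 by (rule prob_space_uniform01)
  have C01: "0 \<le> C x" "C x \<le> 1" for x by (simp_all add: cdf_nonneg cdf_bounded_prob)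
  have I_meas[measurable]: "I \<in> borel_measurable uniform01"
    using measurable_CI
    by (subst measurable_cong_sets[OF sets_restrict_space_cong[OF sets_lborel] refl])
  have ln_meas[measurable]: "ln \<in> borel_measurable uniform01"
      "(\<lambda>u. ln (1 - u)) \<in> borel_measurable uniform01"
    by (auto intro!: measurable_restrict_space1)
  have I_sq: "integrable uniform01 (\<lambda>u. (I u - m)\<^sup>2)"
  proof -
    have "integrable (distr uniform01 borel I) (\<lambda>x. (x - m)\<^sup>2)"
      unfolding distr_I_eq_M by (fact sq)
    then show ?thesis by (subst (asm) integrable_distr_eq) simp_all
  qed
  have I_var: "(LINT u|uniform01. (I u - m)\<^sup>2) = s\<^sup>2"
  proof -
    have "(LINT u|uniform01. (I u - m)\<^sup>2) = (LINT x|distr uniform01 borel I. (x - m)\<^sup>2)"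
      by (subst integral_distr) simp_all
    then show ?thesis unfolding distr_I_eq_M var .
  qed
  have ln_sq: "integrable uniform01 (\<lambda>u. (ln u)\<^sup>2)" "integrable uniform01 (\<lambda>u. (ln (1 - u))\<^sup>2)"
    using ln_square_integral(1) ln_one_minus_square_integral(1) by (simp_all add: integral_uniform01)
  have ln_int: "integrable uniform01 ln" "integrable uniform01 (\<lambda>u. ln (1 - u))"
    using U.square_integrable_imp_integrable ln_sq ln_meas by blast+
  have Y_int: "integrable uniform01 (\<lambda>u. I u - m)"
    by (rule U.square_integrable_imp_integrable[OF _ I_sq]) simp
  have prod_int: "integrable uniform01 (\<lambda>u. (I u - m) * ln u)"
      "integrable uniform01 (\<lambda>u. (I u - m) * ln (1 - u))"
    by (rule integrable_mult_of_squares[OF _ _ I_sq]; use ln_sq in simp)+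
  have int1: "integrable uniform01 (\<lambda>u. I u * (1 + ln u))"
  proof -
    have "integrable uniform01 (\<lambda>u. (I u - m) + (I u - m) * ln u + m * (1 + ln u))"
      by (intro Bochner_Integration.integrable_add integrable_mult_right Y_int prod_int ln_int) simp
    then show ?thesis by (simp add: algebra_simps)
  qed
  have int2: "integrable uniform01 (\<lambda>u. I u * (- 1 - ln (1 - u)))"
  proof -
    have "integrable uniform01 (\<lambda>u. - (I u - m) - (I u - m) * ln (1 - u) + m * (- 1 - ln (1 - u)))"
      by (intro Bochner_Integration.integrable_add Bochner_Integration.integrable_diff
          Bochner_Integration.integrable_minus integrable_mult_right Y_int prod_int ln_int) simp
    then show ?thesis by (simp add: algebra_simps)
  qed
  have score_int: "set_integrable lborel {0<..<1} (\<lambda>u::real. 1 + ln u)"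
      "set_integrable lborel {0<..<1} (\<lambda>u::real. - 1 - ln (1 - u))"
    using ln_int by (simp_all flip: integral_uniform01(1))
  note q = quantile_nonneg[OF nonneg]
  have m1: "(\<lambda>u. 1 + ln u) \<in> borel_measurable (borel :: real measure)"
    and m2: "(\<lambda>u. - 1 - ln (1 - u)) \<in> borel_measurable (borel :: real measure)" by simp_all
  note E1 = integral_quantile_times[OF q m1 int1, unfolded integral_tail_score_cumulative[OF C01 score_int(1)]]
  note E2 = integral_quantile_times[OF q m2 int2, unfolded integral_tail_score_residual[OF C01 score_int(2)]]
  show "set_integrable lborel {0..} (\<lambda>x. C x * ln (C x))"
    using E1(1) by (simp add: set_integrable_def)
  show "set_integrable lborel {0..} (\<lambda>x. (1 - C x) * ln (1 - C x))"
    using E2(1) by (simp add: set_integrable_def)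
  have score_zero: "(LINT u|uniform01. 1 + ln u) = 0" "(LINT u|uniform01. - 1 - ln (1 - u)) = 0"
    unfolding integral_uniform01
    using integral_tail_score_cumulative[of 0] integral_tail_score_residual[of 0] score_int by simp_all
  have centred: "(LINT u|uniform01. ln u - ln (1 - u)) = 0"
  proof -
    have "(LINT u|uniform01. ln u - ln (1 - u)) = (LINT u|uniform01. (1 + ln u) + (- 1 - ln (1 - u)))"
      by simp
    also have "\<dots> = (LINT u|uniform01. 1 + ln u) + (LINT u|uniform01. - 1 - ln (1 - u))"
      by (rule Bochner_Integration.integral_add) (use ln_int in simp_all)
    finally show ?thesis by (simp add: score_zero)
  qed
  have "- (LINT x:{0..}|lborel. (1 - C x) * ln (1 - C x)) + - (LINT x:{0..}|lborel. C x * ln (C x))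
      = (LINT u|uniform01. I u * (1 + ln u)) + (LINT u|uniform01. I u * (- 1 - ln (1 - u)))"
    using E1(2) E2(2) by (simp add: set_lebesgue_integral_def)
  also have "\<dots> = (LINT u|uniform01. I u * (1 + ln u) + I u * (- 1 - ln (1 - u)))"
    by (rule Bochner_Integration.integral_add[symmetric, OF int1 int2])
  also have "\<dots> = (LINT u|uniform01. ((I u - m) * ln u - (I u - m) * ln (1 - u)) + m * (ln u - ln (1 - u)))"
    by (rule Bochner_Integration.integral_cong) (simp_all add: algebra_simps)
  also have "\<dots> = (LINT u|uniform01. (I u - m) * ln u - (I u - m) * ln (1 - u))
      + m * (LINT u|uniform01. ln u - ln (1 - u))"
    using ln_int prod_int by (subst Bochner_Integration.integral_add) simp_all
  also have "\<dots> = (LINT u|uniform01. (I u - m) * ln u - (I u - m) * ln (1 - u))"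
    by (simp add: centred)
  also have "\<dots> \<le> (LINT u|uniform01. (I u - m)\<^sup>2 / s + s / 4 * ((ln u)\<^sup>2 + (ln (1 - u))\<^sup>2))"
  proof (rule integral_mono)
    show "integrable uniform01 (\<lambda>u. (I u - m) * ln u - (I u - m) * ln (1 - u))"
      using prod_int by simp
    show "integrable uniform01 (\<lambda>u. (I u - m)\<^sup>2 / s + s / 4 * ((ln u)\<^sup>2 + (ln (1 - u))\<^sup>2))"
      using I_sq ln_sq by simp
    fix u assume "u \<in> space uniform01"
    then have u: "0 < u" "u < 1" by (simp_all add: space_restrict_space)
    \<comment> \<open>The weights balance the second moment \<open>s\<^sup>2\<close> of \<open>y\<close> against the bound \<open>4\<close> for that of \<open>d\<close>:
      each summand integrates to at most \<open>s\<close>.\<close>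
    define y d where "y = I u - m" and "d = ln u - ln (1 - u)"
    have "0 \<le> (y / s - d / 2)\<^sup>2 * s" using \<open>0 < s\<close> by simp
    also have "\<dots> = y\<^sup>2 / s + s / 4 * d\<^sup>2 - y * d"
      using \<open>0 < s\<close> by (simp add: power2_eq_square field_simps)
    finally have "y * d \<le> y\<^sup>2 / s + s / 4 * d\<^sup>2" by simp
    \<comment> \<open>Both logarithms are nonpositive, so the cross term \<open>- 2 * ln u * ln (1 - u)\<close> can be dropped.\<close>
    also have "d\<^sup>2 \<le> (ln u)\<^sup>2 + (ln (1 - u))\<^sup>2"
      using u mult_nonpos_nonpos[of "ln u" "ln (1 - u)"] by (simp add: d_def power2_diff)
    finally show "(I u - m) * ln u - (I u - m) * ln (1 - u)
        \<le> (I u - m)\<^sup>2 / s + s / 4 * ((ln u)\<^sup>2 + (ln (1 - u))\<^sup>2)"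
      using \<open>0 < s\<close> by (simp add: y_def d_def algebra_simps)
  qed
  also have "\<dots> = s\<^sup>2 / s + s / 4 * (2 + 2)"
    using I_sq ln_sq I_var ln_square_integral(2) ln_one_minus_square_integral(2)
    by (simp add: integral_uniform01(2)[of "\<lambda>u. (ln u)\<^sup>2"] integral_uniform01(2)[of "\<lambda>u. (ln (1 - u))\<^sup>2"])
  also have "\<dots> = 2 * s" using \<open>0 < s\<close> by (simp add: power2_eq_square)
  finally show "- (LINT x:{0..}|lborel. (1 - C x) * ln (1 - C x)) + - (LINT x:{0..}|lborel. C x * ln (C x))
      \<le> 2 * s" .
qed

section \<open>Numerical enclosure of the series\<close>

text \<open>
  With \<open>s = sqrt n\<close> and \<open>t = sqrt (n + 1)\<close> this measures how far the summand
  \<open>1 / (n sqrt (n + 1))\<close> is from the difference of consecutive values of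
  \<open>2 / sqrt n + c / sqrt n ^ 3\<close>.  The first term of that function is the leading term of the
  remainder of the series; \<open>c\<close> corrects the next order and decides the sign of the difference.
\<close>

lemma telescoping_defect:
  fixes s t c :: real
  assumes "0 < s" "t\<^sup>2 = s\<^sup>2 + 1" "0 < t"
  shows "(2 / s + c / s ^ 3) - (2 / t + c / t ^ 3) - 1 / (s\<^sup>2 * t)
    = (c * ((s\<^sup>2 + s * t + t\<^sup>2) * (s + t)) - s * t\<^sup>2) / (s ^ 3 * t ^ 3 * (s + t)\<^sup>2)"
proof -
  have 1: "(t - s) * (t + s) = 1" using assms(2) by (simp add: algebra_simps power2_eq_square)
  then have d: "t - s = 1 / (s + t)" using assms(1,3) by (simp add: eq_divide_eq add.commute)
  have "2 / s - 2 / t - 1 / (s\<^sup>2 * t) = (2 * s * (t - s) - 1) / (s\<^sup>2 * t)"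
    using assms(1,3) by (simp add: field_simps power2_eq_square)
  also have "2 * s * (t - s) - 1 = 2 * s * (t - s) - (t - s) * (t + s)" using 1 by simp
  also have "\<dots> = - ((t - s)\<^sup>2)" by (simp add: algebra_simps power2_eq_square)
  also have "(t - s)\<^sup>2 = 1 / (s + t)\<^sup>2" unfolding d by (simp add: power_divide)
  finally have A: "2 / s - 2 / t - 1 / (s\<^sup>2 * t) = - (1 / (s + t)\<^sup>2) / (s\<^sup>2 * t)" .
  have "c / s ^ 3 - c / t ^ 3 = c * ((s\<^sup>2 + s * t + t\<^sup>2) * (t - s)) / (s ^ 3 * t ^ 3)"
    using assms(1,3) by (simp add: field_simps power2_eq_square power3_eq_cube)
  also have "\<dots> = c * ((s\<^sup>2 + s * t + t\<^sup>2) / (s + t)) / (s ^ 3 * t ^ 3)"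
    unfolding d by simp
  finally have B: "c / s ^ 3 - c / t ^ 3 = c * ((s\<^sup>2 + s * t + t\<^sup>2) / (s + t)) / (s ^ 3 * t ^ 3)" .
  have "(2 / s + c / s ^ 3) - (2 / t + c / t ^ 3) - 1 / (s\<^sup>2 * t)
    = (2 / s - 2 / t - 1 / (s\<^sup>2 * t)) + (c / s ^ 3 - c / t ^ 3)" by simp
  also have "\<dots> = - (1 / (s + t)\<^sup>2) / (s\<^sup>2 * t) + c * ((s\<^sup>2 + s * t + t\<^sup>2) / (s + t)) / (s ^ 3 * t ^ 3)"
    unfolding A B ..
  also have "\<dots> = (c * ((s\<^sup>2 + s * t + t\<^sup>2) * (s + t)) - s * t\<^sup>2) / (s ^ 3 * t ^ 3 * (s + t)\<^sup>2)"
  proof -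
    have "- (1 / w\<^sup>2) / (s\<^sup>2 * t) + c * (q / w) / (s ^ 3 * t ^ 3)
        = (c * (q * w) - s * t\<^sup>2) / (s ^ 3 * t ^ 3 * w\<^sup>2)" if "w \<noteq> 0" for q w
    proof -
      have "1 / (w\<^sup>2 * (s\<^sup>2 * t)) = s * t\<^sup>2 / (s ^ 3 * t ^ 3 * w\<^sup>2)"
        using assms(1,3) that by (simp add: frac_eq_eq power2_eq_square power3_eq_cube)
      moreover have "c * (q / w) / (s ^ 3 * t ^ 3) = c * (q * w) / (s ^ 3 * t ^ 3 * w\<^sup>2)"
        using assms(1,3) that by (simp add: frac_eq_eq power2_eq_square)
      ultimately show ?thesis by (simp add: diff_divide_distrib)
    qed
    moreover have "s + t \<noteq> 0" using assms(1,3) by simp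
    ultimately show ?thesis .
  qed
  finally show ?thesis .
qed

definition tail_estimate :: "real \<Rightarrow> nat \<Rightarrow> real" where
  "tail_estimate c n = 2 / sqrt (real n) + c / sqrt (real n) ^ 3"

text \<open>
  For large \<open>n\<close> one has \<open>t \<approx> s\<close>, and the numerator in \<open>telescoping_defect\<close> changes sign at
  \<open>c = 1/6\<close>.  The constants \<open>1/4\<close> and \<open>1/8\<close> lie on either side of it and make the sign
  visible for every \<open>n > 0\<close>, through decompositions into nonnegative summands.
\<close>

lemma tail_estimate_step:
  assumes "n > 0"
  shows "1 / (real n * sqrt (real n + 1)) \<le> tail_estimate (1/4) n - tail_estimate (1/4) (Suc n)"
    "tail_estimate (1/8) n - tail_estimate (1/8) (Suc n) \<le> 1 / (real n * sqrt (real n + 1))"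
proof -
  define s where "s = sqrt (real n)"
  define t where "t = sqrt (real n + 1)"
  have st: "0 < s" "0 < t" "t\<^sup>2 = s\<^sup>2 + 1" "s \<le> t" and s2: "s\<^sup>2 = real n"
    using assms by (auto simp: s_def t_def)
  have "1 \<le> s\<^sup>2" using assms s2 by simp
  then have "t\<^sup>2 \<le> (3 * s)\<^sup>2" using st by (simp add: power_mult_distrib)
  then have t3: "t \<le> 3 * s" by (rule power2_le_imp_le) (use st(1) in simp)
  have est: "tail_estimate c n - tail_estimate c (Suc n) - 1 / (real n * sqrt (real n + 1))
      = (c * ((s\<^sup>2 + s * t + t\<^sup>2) * (s + t)) - s * t\<^sup>2) / (s ^ 3 * t ^ 3 * (s + t)\<^sup>2)" for c
    using telescoping_defect[OF st(1,3,2), of c] s2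
    by (simp add: tail_estimate_def s_def t_def add.commute)
  have den: "0 < s ^ 3 * t ^ 3 * (s + t)\<^sup>2" using st(1,2) by simp
  have "(s\<^sup>2 + s * t + t\<^sup>2) * (s + t) - 4 * (s * t\<^sup>2) = s ^ 3 + s\<^sup>2 * t + t * (t - s)\<^sup>2"
    by (simp add: algebra_simps power2_eq_square power3_eq_cube)
  also have "\<dots> \<ge> 0" using st(1,2) by simp
  finally have "0 \<le> 1/4 * ((s\<^sup>2 + s * t + t\<^sup>2) * (s + t)) - s * t\<^sup>2" by linarith
  from divide_nonneg_pos[OF this den]
  show "1 / (real n * sqrt (real n + 1)) \<le> tail_estimate (1/4) n - tail_estimate (1/4) (Suc n)"
    using est[of "1/4"] by linarith
  have "8 * (s * t\<^sup>2) - (s\<^sup>2 + s * t + t\<^sup>2) * (s + t)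
     = s * (t - s) * (t + s) + 2 * s * t * (t - s) + t\<^sup>2 * (3 * s - t)"
    by (simp add: algebra_simps power2_eq_square power3_eq_cube)
  also have "\<dots> \<ge> 0" using st(1,2,4) t3 by (intro add_nonneg_nonneg mult_nonneg_nonneg) auto
  finally have "1/8 * ((s\<^sup>2 + s * t + t\<^sup>2) * (s + t)) - s * t\<^sup>2 \<le> 0" by linarith
  from divide_nonpos_pos[OF this den]
  show "tail_estimate (1/8) n - tail_estimate (1/8) (Suc n) \<le> 1 / (real n * sqrt (real n + 1))"
    using est[of "1/8"] by linarith
qed

lemma partial_sum_enclosures:
  defines "a \<equiv> \<lambda>n. 1 / (real (Suc n) * sqrt (real (Suc n) + 1))"
  shows "summable a"
    "suminf a \<le> (\<Sum>n<m. a n) + tail_estimate (1/4) (Suc m)"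
    "(\<Sum>n<m. a n) + tail_estimate (1/8) (Suc m) \<le> suminf a"
proof -
  have lim: "(\<lambda>n. tail_estimate c (n + Suc k)) \<longlonglongrightarrow> 0" for c k
  proof -
    have r: "filterlim (\<lambda>n. sqrt (real n)) at_top sequentially"
      by (rule filterlim_compose[OF sqrt_at_top filterlim_real_sequentially])
    have "filterlim (\<lambda>n. sqrt (real n) ^ 3) at_top sequentially"
      by (rule filterlim_pow_at_top[OF _ r]) simp
    from tendsto_add[OF tendsto_divide_0[OF tendsto_const filterlim_at_top_imp_at_infinity[OF r]]
      tendsto_divide_0[OF tendsto_const filterlim_at_top_imp_at_infinity[OF this]], of 2 c]
    have "tail_estimate c \<longlonglongrightarrow> 0" by (simp add: tail_estimate_def[abs_def])
    then show ?thesis by (rule LIMSEQ_ignore_initial_segment)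
  qed
  have tele: "(\<lambda>n. tail_estimate c (n + Suc k) - tail_estimate c (Suc (n + Suc k))) sums
      tail_estimate c (Suc k)" for c k
    using telescope_sums'[OF lim[of c k]] by simp
  have ub: "a (n + k) \<le> tail_estimate (1/4) (n + Suc k) - tail_estimate (1/4) (Suc (n + Suc k))" for n k
    using tail_estimate_step(1)[of "n + Suc k"] by (simp add: a_def add_ac)
  have lb: "tail_estimate (1/8) (n + Suc k) - tail_estimate (1/8) (Suc (n + Suc k)) \<le> a (n + k)" for n k
    using tail_estimate_step(2)[of "n + Suc k"] by (simp add: a_def add_ac)
  have pos: "0 \<le> a n" for n by (simp add: a_def)
  show sm: "summable a"
    using ub[of _ 0] pos by (intro summable_comparison_test'[OF sums_summable[OF tele[of "1/4" 0]], of 0]) auto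
  have sm': "summable (\<lambda>n. a (n + m))" using sm by simp
  have split: "suminf a = (\<Sum>n. a (n + m)) + (\<Sum>n<m. a n)"
    using suminf_split_initial_segment[OF sm] .
  show "suminf a \<le> (\<Sum>n<m. a n) + tail_estimate (1/4) (Suc m)"
    using suminf_le[OF ub sm' sums_summable[OF tele]] sums_unique[OF tele[of "1/4" m]] split by simp
  show "(\<Sum>n<m. a n) + tail_estimate (1/8) (Suc m) \<le> suminf a"
    using suminf_le[OF lb sums_summable[OF tele] sm'] sums_unique[OF tele[of "1/8" m]] split by simp
qed

lemma sqrt_enclosures:
  "141421 / 100000 \<le> sqrt (2::real)" "sqrt (2::real) \<le> 141422 / 100000"
  "173205 / 100000 \<le> sqrt (3::real)" "sqrt (3::real) \<le> 173206 / 100000"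
  "223606 / 100000 \<le> sqrt (5::real)" "sqrt (5::real) \<le> 223607 / 100000"
  "244948 / 100000 \<le> sqrt (6::real)" "sqrt (6::real) \<le> 244949 / 100000"
  "264575 / 100000 \<le> sqrt (7::real)" "sqrt (7::real) \<le> 264576 / 100000"
  by (rule real_le_rsqrt real_le_lsqrt; simp add: power2_eq_square)+

text \<open>
  Eight terms suffice: the two estimates of the remainder then differ by \<open>1/216\<close>, and they are
  rational because the first omitted index is \<open>9\<close>.
\<close>

lemma series_enclosure:
  "summable (\<lambda>n. 1 / (real (Suc n) * sqrt (real (Suc n) + 1)))"
  "\<bar>sqrt 2 * (\<Sum>n. 1 / (real (Suc n) * sqrt (real (Suc n) + 1))) - 3.09\<bar> < 0.005"
proof -
  let ?a = "\<lambda>n. 1 / (real (Suc n) * sqrt (real (Suc n) + 1))"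
  show "summable ?a" using partial_sum_enclosures(1) .
  have r4: "sqrt 4 = (2::real)" and r9: "sqrt 9 = (3::real)"
    by (simp_all add: real_sqrt_unique)
  have r8: "sqrt 8 = 2 * sqrt (2::real)"
    using real_sqrt_mult[of 4 2] r4 by simp
  have rat: "1 / (k * sqrt x) = sqrt x / (k * x)" if "x > 0" for k x :: real
    using that by (simp add: divide_simps)
  have first_eight: "(\<Sum>n<8. h n) = h 0 + h 1 + h 2 + h 3 + h 4 + h 5 + h 6 + h 7"
    for h :: "nat \<Rightarrow> real"
    by (simp add: numeral_eq_Suc)
  have S: "(\<Sum>n<8. ?a n) = sqrt 2 / 2 + sqrt 3 / 6 + 1 / 6 + sqrt 5 / 20 + sqrt 6 / 30
      + sqrt 7 / 42 + sqrt 2 / 28 + 1 / 24"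
    unfolding first_eight
    using rat[of 2 1] rat[of 3 2] rat[of 5 4] rat[of 6 5] rat[of 7 6] rat[of 8 7] r4 r8 r9 by simp
  have T: "tail_estimate c (Suc 8) = 2 / 3 + c / 27" for c
    by (simp add: tail_estimate_def r9)
  have lo: "21822 / 10000 \<le> suminf ?a" and hi: "suminf ?a \<le> 21880 / 10000"
    using partial_sum_enclosures(2,3)[of 8] sqrt_enclosures unfolding S T by linarith+
  have enclose: "\<bar>r * x - 3.09\<bar> < 0.005"
    if "141421 / 100000 \<le> r" "r \<le> 141422 / 100000" "21822 / 10000 \<le> x" "x \<le> 21880 / 10000"
    for r x :: real
  proof -
    have "141421 / 100000 * (21822 / 10000) \<le> r * x"
      using that by (intro mult_mono) linarith+
    moreover have "r * x \<le> 141422 / 100000 * (21880 / 10000)"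
      using that by (intro mult_mono) linarith+
    moreover have "(3.09 :: real) = 309 / 100" "(0.005 :: real) = 5 / 1000" by simp_all
    ultimately show ?thesis unfolding abs_less_iff by linarith
  qed
  show "\<bar>sqrt 2 * suminf ?a - 3.09\<bar> < 0.005"
    by (rule enclose[OF sqrt_enclosures(1,2) lo hi])
qed

lemma entropy_bound_series:
  assumes "\<sigma> > 0"
  shows "summable (entropy_bound_term \<sigma>)"
    and "\<bar>(\<Sum>n. entropy_bound_term \<sigma> n) - 3.09 * \<sigma>\<bar> < 0.005 * \<sigma>"
proof -
  let ?a = "\<lambda>n. 1 / (real (Suc n) * sqrt (real (Suc n) + 1))"
  have factored: "entropy_bound_term \<sigma> = (\<lambda>n. sqrt 2 * \<sigma> * ?a n)"
    by (simp add: entropy_bound_term_def fun_eq_iff)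
  show "summable (entropy_bound_term \<sigma>)"
    unfolding factored by (rule summable_mult[OF series_enclosure(1)])
  have total: "suminf (entropy_bound_term \<sigma>) = sqrt 2 * \<sigma> * suminf ?a"
    unfolding factored by (rule suminf_mult[OF series_enclosure(1)])
  have scale: "\<bar>r * \<sigma> * x - c * \<sigma>\<bar> < e * \<sigma>" if "\<bar>r * x - c\<bar> < e" for r x c e
  proof -
    have "r * \<sigma> * x - c * \<sigma> = (r * x - c) * \<sigma>" by (simp add: algebra_simps)
    then have "\<bar>r * \<sigma> * x - c * \<sigma>\<bar> = \<bar>r * x - c\<bar> * \<sigma>"
      using assms by (simp add: abs_mult)
    also have "\<dots> < e * \<sigma>" using that assms by (rule mult_strict_right_mono)
    finally show ?thesis .
  qed
  show "\<bar>suminf (entropy_bound_term \<sigma>) - 3.09 * \<sigma>\<bar> < 0.005 * \<sigma>"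
    unfolding total by (rule scale[OF series_enclosure(2)])
qed

theorem theorem5:
  fixes M :: "'a measure" and X :: "'a \<Rightarrow> real" and f :: "real \<Rightarrow> ennreal" and \<sigma> :: real
  assumes "prob_space M"
    and "distributed M lborel X f"
    and "AE \<omega> in M. 0 \<le> X \<omega>"
    and "integrable M X"
    and "integrable M (\<lambda>\<omega>. (X \<omega> - prob_space.expectation M X)\<^sup>2)"
    and "prob_space.variance M X = \<sigma>\<^sup>2"
    and "\<sigma> > 0"
  shows "finite_cumulative_residual_entropy M X \<and> finite_cumulative_entropy M X \<and>
         summable (entropy_bound_term \<sigma>) \<and>
         cumulative_residual_entropy M X + cumulative_entropy M X
           \<le> (\<Sum>n. entropy_bound_term \<sigma> n) \<and>
         \<bar>(\<Sum>n. entropy_bound_term \<sigma> n) - 3.09 * \<sigma>\<bar> < 0.005 * \<sigma>"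
proof -
  interpret M: prob_space M by fact
  have X[measurable]: "X \<in> borel_measurable M"
    using distributed_measurable[OF assms(2)] by simp
  interpret D: cdf_distribution "distr M borel X"
    unfolding cdf_distribution_def by (rule M.real_distribution_distr[OF X])
  let ?m = "M.expectation X"
  have nonneg: "AE x in distr M borel X. 0 \<le> x"
    using assms(3) by (subst AE_distr_iff) simp_all
  have sq: "integrable (distr M borel X) (\<lambda>x. (x - ?m)\<^sup>2)"
    using assms(5) by (subst integrable_distr_eq) simp_all
  have var: "(LINT x|distr M borel X. (x - ?m)\<^sup>2) = \<sigma>\<^sup>2"
    using assms(6) by (subst integral_distr) simp_all
  note ent = D.entropies_via_quantile[OF nonneg sq var \<open>\<sigma> > 0\<close>]
  note bound = entropy_bound_series[OF \<open>\<sigma> > 0\<close>]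
  have "cumulative_residual_entropy M X + cumulative_entropy M X \<le> 2 * \<sigma>"
    using ent(3) by (simp add: cumulative_residual_entropy_def cumulative_entropy_def)
  also have "2 * \<sigma> \<le> suminf (entropy_bound_term \<sigma>)"
  proof -
    have decimals: "(3.09 :: real) = 309 / 100" "(0.005 :: real) = 5 / 1000" by simp_all
    show ?thesis
      using bound(2) \<open>\<sigma> > 0\<close> unfolding decimals abs_less_iff by linarith
  qed
  finally show ?thesis
    unfolding finite_cumulative_residual_entropy_def finite_cumulative_entropy_def
    using ent(1,2) bound by blast
qed

end
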